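(* Let $\mathcal{A}=(S,S_0,\{A_i\}_{i=1}^n)$ be a parameterized multi-stack pushdown system and $k\in\mathbb{N}$. Then reachability under $k$-round schedules in $\mathcal{A}$ reduces to (ordinary) reachability in a pushdown system $\mathcal{A}_k$ constructed from $\mathcal{A}$ and $k$. Moreover, the size of $\mathcal{A}_k$ is singly exponential in $k$ and linear in the product of the number of locations and transitions of $\mathcal{A}$; specifically, $\mathcal{A}_k$ has $O(\ell\, k^2\, |S|^{2k})$ locations and $O(\ell\, d\, k^3\, |S|^{2k-1})$ transitions, where $\ell=\sum_{i=1}^n |L_i|$ and $d$ is the total number of transitions of $A_1,\dots,A_n$.
   Context: A parameterized multi-stack pushdown system is a tuple $\mathcal{A}=(S,S_0,\{A_i\}_{i=1}^n)$ where $S$ is a finite set of shared locations, $S_0\subseteq S$ the initial shared locations, and each $A_i$ is a pushdown system whose control locations are $S\times L_i$ for a finite set $L_i$. A run of $\mathcal{A}$ involves an arbitrary finite number $m$ of threads $T_1,\dots,T_m$, each a copy of some $A_i$ with its own local location in $L_i$ and its own stack; the shared location $s\in S$ is common. A run starts from a shared location in $S_0$ with each thread in an initial local configuration; at each step the active thread performs a transition of its pushdown system on $(s,l)$ and its own stack, or control switches to another thread. Pairs $(s,l)\in S\times L_i$ are the localized states. A $k$-round schedule is one where, for some ordering $T_1,\dots,T_m$ of the threads, the threads are activated in $k$ rounds, each round scheduling each thread once in this order for an arbitrary number of steps. Reachability under $k$-round schedules asks whether a given localized state is reached in some run following a $k$-round schedule. *)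

theory Defs
  imports Main
begin

section \<open>Pushdown systems\<close>

text \<open>The bottom-of-stack symbol is implicit: a stack is the list (top first) of the symbols above
  the bottom, and \<open>Bot\<close> reads the bottom symbol, which is never removed.\<close>

datatype 'g act = Internal | Push 'g | Pop 'g | Bot

fun act_rel :: "'g act \<Rightarrow> 'g list \<Rightarrow> 'g list \<Rightarrow> bool" where
  "act_rel Internal st st' \<longleftrightarrow> st' = st"
| "act_rel (Push g) st st' \<longleftrightarrow> st' = g # st"
| "act_rel (Pop g) st st' \<longleftrightarrow> st = g # st'"
| "act_rel Bot st st' \<longleftrightarrow> st = [] \<and> st' = []"

record ('q, 'g) pds =
  locs :: "'q set"
  inits :: "'q set"
  alph :: "'g set"
  delta :: "('q \<times> 'g act \<times> 'q) set"

definition wf_pds :: "('q, 'g) pds \<Rightarrow> bool" where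
  "wf_pds P \<longleftrightarrow> finite (locs P) \<and> inits P \<subseteq> locs P \<and> finite (alph P) \<and>
     (\<forall>(q, a, q') \<in> delta P. q \<in> locs P \<and> q' \<in> locs P \<and> set_act a \<subseteq> alph P)"

definition pds_step :: "('q, 'g) pds \<Rightarrow> 'q \<times> 'g list \<Rightarrow> 'q \<times> 'g list \<Rightarrow> bool" where
  "pds_step P = (\<lambda>(q, st) (q', st'). \<exists>a. (q, a, q') \<in> delta P \<and> act_rel a st st')"

definition pds_reachable :: "('q, 'g) pds \<Rightarrow> 'q set \<Rightarrow> bool" where
  "pds_reachable P T \<longleftrightarrow>
     (\<exists>q0 \<in> inits P. \<exists>q \<in> T. \<exists>st. (pds_step P)\<^sup>*\<^sup>* (q0, []) (q, st))"


section \<open>Parameterized multi-stack pushdown systems\<close>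

record ('s, 'l, 'g) component =
  local_locs :: "'l set"
  local_inits :: "'l set"
  comp_alph :: "'g set"
  comp_trans :: "(('s \<times> 'l) \<times> 'g act \<times> ('s \<times> 'l)) set"

record ('s, 'l, 'g) psys =
  shared :: "'s set"
  shared0 :: "'s set"
  comps :: "('s, 'l, 'g) component list"

definition comp_pds :: "('s, 'l, 'g) psys \<Rightarrow> nat \<Rightarrow> ('s \<times> 'l, 'g) pds" where
  "comp_pds A i =
     \<lparr> locs = shared A \<times> local_locs (comps A ! i),
       inits = shared0 A \<times> local_inits (comps A ! i),
       alph = comp_alph (comps A ! i),
       delta = comp_trans (comps A ! i) \<rparr>"

definition wf_psys :: "('s, 'l, 'g) psys \<Rightarrow> bool" where
  "wf_psys A \<longleftrightarrow> finite (shared A) \<and> shared0 A \<subseteq> shared A \<and>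
     (\<forall>i < length (comps A).
        finite (local_locs (comps A ! i)) \<and>
        local_inits (comps A ! i) \<subseteq> local_locs (comps A ! i) \<and>
        wf_pds (comp_pds A i))"

definition num_locals :: "('s, 'l, 'g) psys \<Rightarrow> nat" where
  "num_locals A = (\<Sum>i < length (comps A). card (local_locs (comps A ! i)))"

definition num_trans :: "('s, 'l, 'g) psys \<Rightarrow> nat" where
  "num_trans A = (\<Sum>i < length (comps A). card (comp_trans (comps A ! i)))"

text \<open>A thread is given by the index of the component it is a copy of, its local location and its
  stack; a configuration by the shared location and the list of all threads.\<close>

type_synonym ('s, 'l, 'g) config = "'s \<times> (nat \<times> 'l \<times> 'g list) list"

definition init_config :: "('s, 'l, 'g) psys \<Rightarrow> ('s, 'l, 'g) config \<Rightarrow> bool" where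
  "init_config A = (\<lambda>(s, ths). s \<in> shared0 A \<and>
     (\<forall>(i, l, st) \<in> set ths. i < length (comps A) \<and> l \<in> local_inits (comps A ! i) \<and> st = []))"

definition thread_step ::
  "('s, 'l, 'g) psys \<Rightarrow> nat \<Rightarrow> ('s, 'l, 'g) config \<Rightarrow> ('s, 'l, 'g) config \<Rightarrow> bool" where
  "thread_step A t = (\<lambda>(s, ths) (s', ths'). t < length ths \<and>
     (\<exists>i l st l' st'. ths ! t = (i, l, st) \<and>
        pds_step (comp_pds A i) ((s, l), st) ((s', l'), st') \<and> ths' = ths[t := (i, l', st')]))"

text \<open>Execution along a list of successive activations, each lasting for any number of steps
  (possibly none).\<close>

inductive exec ::
  "('s, 'l, 'g) psys \<Rightarrow> nat list \<Rightarrow> ('s, 'l, 'g) config \<Rightarrow> ('s, 'l, 'g) config \<Rightarrow> bool"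
  for A :: "('s, 'l, 'g) psys" where
  exec_Nil: "exec A [] c c"
| exec_Cons: "(thread_step A t)\<^sup>*\<^sup>* c c' \<Longrightarrow> exec A ts c' c'' \<Longrightarrow> exec A (t # ts) c c''"

definition k_round_schedule :: "nat \<Rightarrow> nat \<Rightarrow> nat list \<Rightarrow> bool" where
  "k_round_schedule m k ts \<longleftrightarrow>
     (\<exists>order. distinct order \<and> set order = {..<m} \<and> ts = concat (replicate k order))"

text \<open>A localized state is the view of a configuration by the active thread: the shared location
  together with the local location of that thread. It is tagged with the component index, so that
  the sets of local locations need not be disjoint. The activations \<open>vs\<close> after the visit are
  irrelevant, since threads may always be scheduled for no step at all.\<close>

definition k_round_reachable ::
  "('s, 'l, 'g) psys \<Rightarrow> nat \<Rightarrow> nat \<Rightarrow> 's \<Rightarrow> 'l \<Rightarrow> bool" where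
  "k_round_reachable A k i s l \<longleftrightarrow>
     (\<exists>c0 us t vs c ths st. init_config A c0 \<and>
        k_round_schedule (length (snd c0)) k (us @ t # vs) \<and>
        exec A us c0 c \<and> (thread_step A t)\<^sup>*\<^sup>* c (s, ths) \<and> ths ! t = (i, l, st))"


section \<open>The sequential pushdown system\<close>

text \<open>The threads are simulated one after the other, each through all of its rounds.
  Rounds are numbered from \<open>0\<close>. In \<open>Run f i l j w v\<close> the current thread, a copy of component \<open>i\<close>, is
  in local location \<open>l\<close> and round \<open>j\<close>; \<open>v ! r\<close> is the shared location reached so far in round \<open>r\<close>
  (so \<open>v ! j\<close> is the current one), and \<open>w ! r\<close> is the location guessed at the beginning as the one
  in which round \<open>r + 1\<close> starts. The flag \<open>f\<close> marks the last thread in the ordering, which has to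
  confirm these guesses: it leaves round \<open>r\<close> only if \<open>v ! r = w ! r\<close>. Hence every localized state
  of that thread is really reached. It is enough to observe the last thread: rotating the ordering
  makes any given thread the last one, the threads rotated to the front being idle in the first
  round. In \<open>Hub w v\<close> a thread has been completed and its stack is being emptied before the next
  thread is started.

  If no component has any transition, one thread in its first round visits everything that can be
  visited, so then neither hubs nor changes of round are provided.\<close>

datatype ('s, 'l) seq_loc =
    Run bool nat 'l nat "'s list" "'s list"
  | Hub "'s list" "'s list"

definition vecs :: "'s set \<Rightarrow> nat \<Rightarrow> 's list set" where
  "vecs X m = {xs. length xs = m \<and> set xs \<subseteq> X}"

definition seq_locs :: "('s, 'l, 'g) psys \<Rightarrow> nat \<Rightarrow> ('s, 'l) seq_loc set" where
  "seq_locs A k =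
     {Run f i l j w v | f i l j w v.
        i < length (comps A) \<and> l \<in> local_locs (comps A ! i) \<and> j < k \<and>
        w \<in> vecs (shared A) (k - 1) \<and> v \<in> vecs (shared A) k} \<union>
     {Hub w v | w v. 0 < k \<and> 0 < num_trans A \<and>
        w \<in> vecs (shared A) (k - 1) \<and> v \<in> vecs (shared A) k}"

definition seq_inits :: "('s, 'l, 'g) psys \<Rightarrow> nat \<Rightarrow> ('s, 'l) seq_loc set" where
  "seq_inits A k = seq_locs A k \<inter>
     {Run f i l 0 w v | f i l w v.
        l \<in> local_inits (comps A ! i) \<and> v ! 0 \<in> shared0 A \<and> w = tl v}"

inductive seq_rule ::
  "('s, 'l, 'g) psys \<Rightarrow> nat \<Rightarrow> ('s, 'l) seq_loc \<Rightarrow> 'g act \<Rightarrow> ('s, 'l) seq_loc \<Rightarrow> bool"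
  for A :: "('s, 'l, 'g) psys" and k :: nat where
  step: "((v ! j, l), a, (s', l')) \<in> comp_trans (comps A ! i) \<Longrightarrow>
     seq_rule A k (Run f i l j w v) a (Run f i l' j w (v[j := s']))"
| next_round: "0 < num_trans A \<Longrightarrow> (f \<Longrightarrow> v ! j = w ! j) \<Longrightarrow>
     seq_rule A k (Run f i l j w v) Internal (Run f i l (Suc j) w v)"
| retire: "Suc j = k \<Longrightarrow>
     seq_rule A k (Run False i l j w v) Internal (Hub w v)"
| clear: "i < length (comps A) \<Longrightarrow> (q, Push g, q') \<in> comp_trans (comps A ! i) \<Longrightarrow>
     seq_rule A k (Hub w v) (Pop g) (Hub w v)"
| start: "l \<in> local_inits (comps A ! i) \<Longrightarrow>
     seq_rule A k (Hub w v) Bot (Run f i l 0 w v)"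

definition seq_pds :: "('s, 'l, 'g) psys \<Rightarrow> nat \<Rightarrow> (('s, 'l) seq_loc, 'g) pds" where
  "seq_pds A k =
     \<lparr> locs = seq_locs A k,
       inits = seq_inits A k,
       alph = (\<Union>i < length (comps A). comp_alph (comps A ! i)),
       delta = {(q, a, q'). q \<in> seq_locs A k \<and> q' \<in> seq_locs A k \<and> seq_rule A k q a q'} \<rparr>"

definition seq_target ::
  "('s, 'l, 'g) psys \<Rightarrow> nat \<Rightarrow> nat \<Rightarrow> 's \<Rightarrow> 'l \<Rightarrow> ('s, 'l) seq_loc set" where
  "seq_target A k i s l = seq_locs A k \<inter> {Run True i l j w v | j w v. v ! j = s}"

end

(* In a k-round schedule every round starts in the shared location in which the previous one ends,
   so the rounds of a single thread can be run in one go once the k shared locations in which it is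
   entered are known: it turns the vector of entry locations into the one its successor is entered
   with.  A run therefore amounts to a chain of such vectors, threaded through the threads one after
   the other, such that the final vector, shifted by one round, agrees with the initial one.  The
   sequential system guesses the initial vector and checks this agreement while it simulates the
   last thread, round by round, so that only the rounds up to the current one need to fit.

   Conversely, for a visit by an arbitrary thread t, rotate the ordering so that t comes last and let
   the missing activations at the front be idle: the visit then takes place at the end of the k-th
   round, so all k rounds can be simulated without distinguishing unfinished ones. *)
theory Submission
  imports Defs
begin

section \<open>Executions\<close>

lemma exec_Nil_iff [simp]: "exec A [] c c' \<longleftrightarrow> c' = c"
  by (auto elim: exec.cases intro: exec_Nil)

lemma exec_Cons_iff:
  "exec A (t # ts) c c'' \<longleftrightarrow> (\<exists>c'. (thread_step A t)\<^sup>*\<^sup>* c c' \<and> exec A ts c' c'')"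
proof
  assume "exec A (t # ts) c c''"
  then show "\<exists>c'. (thread_step A t)\<^sup>*\<^sup>* c c' \<and> exec A ts c' c''" by cases blast+
qed (blast intro: exec.intros)

lemma exec_append:
  "exec A (xs @ ys) c c'' \<longleftrightarrow> (\<exists>c'. exec A xs c c' \<and> exec A ys c' c'')"
  by (induction xs arbitrary: c) (auto simp: exec_Cons_iff)

text \<open>An activation may last for no step at all, so any sequence of activations can idle. Both
  directions of the reduction fill up schedules in this way.\<close>

lemma exec_refl: "exec A ts c c"
  by (induction ts) (blast intro: exec.intros)+

text \<open>The last activation absorbs one more step of its thread; in the soundness invariant this
  matches the rule \<open>step\<close>.\<close>

lemma exec_snoc_step:
  assumes "exec A (ts @ [t]) c c'" and "thread_step A t c' c''"
  shows "exec A (ts @ [t]) c c''"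
proof -
  from assms(1) obtain d where "exec A ts c d" "(thread_step A t)\<^sup>*\<^sup>* d c'"
    by (auto simp only: exec_append exec_Cons_iff exec_Nil_iff)
  with assms(2) show ?thesis unfolding exec_append
    by (blast intro: exec.intros rtranclp.rtrancl_into_rtrancl)
qed

section \<open>Appending threads and isolating a single thread\<close>

lemma thread_step_append:
  "thread_step A t (s, ths) (s', ths') \<Longrightarrow> thread_step A t (s, ths @ us) (s', ths' @ us)"
  by (fastforce simp: thread_step_def nth_append list_update_append)

lemma thread_steps_append:
  "(thread_step A t)\<^sup>*\<^sup>* (s, ths) (s', ths') \<Longrightarrow>
   (thread_step A t)\<^sup>*\<^sup>* (s, ths @ us) (s', ths' @ us)"
  by (induction rule: rtranclp_induct2)
    (auto intro: rtranclp.rtrancl_into_rtrancl thread_step_append)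

lemma exec_append_threads:
  "exec A ts (s, ths) (s', ths') \<Longrightarrow> exec A ts (s, ths @ us) (s', ths' @ us)"
proof (induction ts arbitrary: s ths)
  case (Cons t ts)
  then obtain s1 ths1 where "(thread_step A t)\<^sup>*\<^sup>* (s, ths) (s1, ths1)"
      "exec A ts (s1, ths1) (s', ths')"
    by (auto simp: exec_Cons_iff)
  from thread_steps_append[OF this(1)] Cons.IH[OF this(2)] show ?case
    by (rule exec.exec_Cons)
qed simp

text \<open>Appending \<open>x\<close> keeps the indices of the other threads, and \<open>x\<close>
  idles when its turn comes. Meant for \<open>length ths = n\<close>, where the added activation
  \<open>n\<close> is that of \<open>x\<close>.\<close>

lemma exec_new_thread:
  assumes "exec A [0..<n] (s, ths) (s', ths')"
  shows "exec A [0..<Suc n] (s, ths @ [x]) (s', ths' @ [x])"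
  using exec_append_threads[OF assms, of "[x]"] exec_refl[of A "[n]"]
  unfolding upt_Suc_append[OF le0] exec_append by blast

lemma thread_steps_pds:
  assumes "(thread_step A t)\<^sup>*\<^sup>* (s, ths) (s', ths')" and "ths ! t = (i, l, st)"
  obtains l' st' where "(pds_step (comp_pds A i))\<^sup>*\<^sup>* ((s, l), st) ((s', l'), st')"
    and "ths' = ths[t := (i, l', st')]"
proof -
  have "\<exists>l' st'. (pds_step (comp_pds A i))\<^sup>*\<^sup>* ((s, l), st) ((s', l'), st') \<and>
      ths' = ths[t := (i, l', st')]"
    using assms
  proof (induction rule: rtranclp_induct2)
    case refl
    then show ?case by (metis list_update_id rtranclp.rtrancl_refl)
  next
    case (step s1 ths1 s2 ths2)
    then obtain l1 st1 where *: "(pds_step (comp_pds A i))\<^sup>*\<^sup>* ((s, l), st) ((s1, l1), st1)"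
        "ths1 = ths[t := (i, l1, st1)]" by auto
    from step.hyps(2) *(2) obtain l2 st2 where
        "pds_step (comp_pds A i) ((s1, l1), st1) ((s2, l2), st2)" "ths2 = ths[t := (i, l2, st2)]"
      by (auto simp: thread_step_def)
    with *(1) show ?case by (blast intro: rtranclp.rtrancl_into_rtrancl)
  qed
  then show thesis using that by blast
qed

lemma thread_steps_other:
  assumes "(thread_step A t)\<^sup>*\<^sup>* c c'" and "t' \<noteq> t"
  shows "snd c' ! t' = snd c ! t'"
  using assms by (induction rule: rtranclp_induct) (auto simp: thread_step_def)

lemma exec_other: "exec A ts c c' \<Longrightarrow> t \<notin> set ts \<Longrightarrow> snd c' ! t = snd c ! t"
  by (induction rule: exec.induct) (auto dest: thread_steps_other)

section \<open>Well-formedness\<close>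

lemma finite_act: "finite G \<Longrightarrow> finite {a. set_act a \<subseteq> G}"
proof -
  assume "finite G"
  moreover have "{a. set_act a \<subseteq> G} \<subseteq> {Internal, Bot} \<union> Push ` G \<union> Pop ` G"
  proof
    fix a :: "'a act" assume "a \<in> {a. set_act a \<subseteq> G}"
    then show "a \<in> {Internal, Bot} \<union> Push ` G \<union> Pop ` G" by (cases a) auto
  qed
  ultimately show ?thesis by (meson finite.emptyI finite.insertI finite_UnI finite_imageI finite_subset)
qed

locale psys =
  fixes A :: "('s, 'l, 'g) psys"
  assumes wf: "wf_psys A"
begin

lemma finite_shared [simp]: "finite (shared A)"
  and shared0_shared: "s \<in> shared0 A \<Longrightarrow> s \<in> shared A"
  using wf by (auto simp: wf_psys_def)

lemma finite_local [simp]: "i < length (comps A) \<Longrightarrow> finite (local_locs (comps A ! i))"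
  and init_local: "i < length (comps A) \<Longrightarrow> l \<in> local_inits (comps A ! i) \<Longrightarrow>
    l \<in> local_locs (comps A ! i)"
  and finite_alph [simp]: "i < length (comps A) \<Longrightarrow> finite (comp_alph (comps A ! i))"
  using wf by (auto simp: wf_psys_def wf_pds_def comp_pds_def)

lemma transD:
  assumes "i < length (comps A)" "((s, l), a, (s', l')) \<in> comp_trans (comps A ! i)"
  shows "s \<in> shared A" "l \<in> local_locs (comps A ! i)" "s' \<in> shared A"
    "l' \<in> local_locs (comps A ! i)" "set_act a \<subseteq> comp_alph (comps A ! i)"
proof -
  have "wf_pds (comp_pds A i)" using wf assms(1) by (simp add: wf_psys_def)
  then have "\<forall>(q, a, q') \<in> comp_trans (comps A ! i). q \<in> shared A \<times> local_locs (comps A ! i) \<and>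
      q' \<in> shared A \<times> local_locs (comps A ! i) \<and> set_act a \<subseteq> comp_alph (comps A ! i)"
    by (simp add: wf_pds_def comp_pds_def)
  from bspec[OF this assms(2)]
  show "s \<in> shared A" "l \<in> local_locs (comps A ! i)" "s' \<in> shared A"
    "l' \<in> local_locs (comps A ! i)" "set_act a \<subseteq> comp_alph (comps A ! i)"
    by simp_all
qed

text \<open>\<open>wf_pds\<close> does not ask for finitely many transitions, and
  \<open>card\<close> is 0 on infinite sets, so the counts need this: a finite alphabet admits only
  finitely many actions.\<close>

lemma finite_trans [simp]:
  assumes "i < length (comps A)" shows "finite (comp_trans (comps A ! i))"
proof (rule finite_subset)
  let ?L = "shared A \<times> local_locs (comps A ! i)"
  show "comp_trans (comps A ! i) \<subseteq> ?L \<times> {a. set_act a \<subseteq> comp_alph (comps A ! i)} \<times> ?L"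
    using transD[OF assms] by fast
  show "finite (?L \<times> {a. set_act a \<subseteq> comp_alph (comps A ! i)} \<times> ?L)"
    using assms by (simp add: finite_act)
qed

lemma trans_pos:
  assumes "i < length (comps A)" "x \<in> comp_trans (comps A ! i)"
  shows "0 < num_trans A"
  unfolding num_trans_def using assms
  by (intro sum_pos2[of _ i]) (auto simp: card_gt_0_iff)

text \<open>A transition has a local location as its source. Terms lacking the factor
  \<open>num_locals A\<close> can thus be absorbed into the size bounds.\<close>

lemma locals_pos:
  assumes "0 < num_trans A" shows "0 < num_locals A"
proof -
  from assms obtain i where i: "i < length (comps A)" "comp_trans (comps A ! i) \<noteq> {}"
    unfolding num_trans_def by (metis card.empty lessThan_iff less_irrefl sum.neutral)
  then obtain s l a s' l' where "((s, l), a, (s', l')) \<in> comp_trans (comps A ! i)" by fast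
  then have "local_locs (comps A ! i) \<noteq> {}" using transD(2)[OF i(1)] by blast
  with i show ?thesis unfolding num_locals_def
    by (intro sum_pos2[of _ i]) (simp_all add: card_gt_0_iff)
qed

lemma finite_comps [simp]:
  "finite (SIGMA i:{..<length (comps A)}. local_locs (comps A ! i))"
  "finite (SIGMA i:{..<length (comps A)}. comp_trans (comps A ! i))"
  by (auto intro!: finite_SigmaI)

lemma card_comps_locals:
  "card (SIGMA i:{..<length (comps A)}. local_locs (comps A ! i)) = num_locals A"
  by (simp add: num_locals_def)

lemma card_comps_trans:
  "card (SIGMA i:{..<length (comps A)}. comp_trans (comps A ! i)) = num_trans A"
  by (simp add: num_trans_def)

lemma tl_vecs: "v \<in> vecs X m \<Longrightarrow> tl v \<in> vecs X (m - 1)"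
  by (cases v) (auto simp: vecs_def)

lemma finite_vecs [simp]: "finite (vecs (shared A) m)"
  unfolding vecs_def using finite_lists_length_eq[OF finite_shared, of m]
  by (simp add: conj_commute)

lemma card_vecs: "card (vecs (shared A) m) = card (shared A) ^ m"
  unfolding vecs_def using card_lists_length_eq[OF finite_shared, of m]
  by (simp add: conj_commute)

lemma seq_locs_0 [simp]: "seq_locs A 0 = {}"
  by (auto simp: seq_locs_def)

lemma Run_in_locs: "Run f i l j w v \<in> seq_locs A k \<longleftrightarrow>
    i < length (comps A) \<and> l \<in> local_locs (comps A ! i) \<and> j < k \<and>
    w \<in> vecs (shared A) (k - 1) \<and> v \<in> vecs (shared A) k"
  by (auto simp: seq_locs_def)

lemma Hub_in_locs: "Hub w v \<in> seq_locs A k \<longleftrightarrow>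
    0 < k \<and> 0 < num_trans A \<and> w \<in> vecs (shared A) (k - 1) \<and> v \<in> vecs (shared A) k"
  by (auto simp: seq_locs_def)

section \<open>Size of the sequential system\<close>

lemma locs_subset:
  "seq_locs A k \<subseteq>
     (\<lambda>(f, (i, l), j, w, v). Run f i l j w v) `
       (UNIV \<times> (SIGMA i:{..<length (comps A)}. local_locs (comps A ! i)) \<times> {..<k} \<times>
        vecs (shared A) (k - 1) \<times> vecs (shared A) k) \<union>
     (if 0 < num_trans A then
        (\<lambda>(w, v). Hub w v) ` (vecs (shared A) (k - 1) \<times> vecs (shared A) k) else {})"
  (is "_ \<subseteq> ?f ` ?X \<union> ?H")
proof
  fix q assume q: "q \<in> seq_locs A k"
  show "q \<in> ?f ` ?X \<union> ?H"
  proof (cases q)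
    case (Run f i l j w v)
    with q show ?thesis by (intro UnI1 image_eqI[of _ _ "(f, (i, l), j, w, v)"]) (auto simp: Run_in_locs)
  qed (use q in \<open>auto simp: Hub_in_locs\<close>)
qed

lemma finite_seq_locs: "finite (seq_locs A k)"
  by (rule finite_subset[OF locs_subset]) simp

lemma card_vec_pairs:
  assumes "0 < k"
  shows "card (vecs (shared A) (k - 1) \<times> vecs (shared A) k) = card (shared A) ^ (2 * k - 1)"
proof -
  have "k - 1 + k = 2 * k - 1" using assms by simp
  then show ?thesis by (simp add: card_cartesian_product card_vecs flip: power_add)
qed

text \<open>With N = |S|^(2k-1) pairs of vectors, the flag, the local location and the round give 2
  * l * k * N \<open>Run\<close> locations, and there are at most N hubs.\<close>

lemma card_seq_locs:
  "card (seq_locs A k) \<le> 3 * (num_locals A * k ^ 2 * card (shared A) ^ (2 * k))"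
proof (cases "k = 0")
  case False
  let ?N = "card (shared A) ^ (2 * k - 1)" and ?l = "num_locals A"
  let ?W = "vecs (shared A) (k - 1)" and ?V = "vecs (shared A) k"
  have N: "card ?W * card ?V = ?N"
    using card_vec_pairs[of k] False by (simp add: card_cartesian_product)
  let ?X = "(UNIV :: bool set) \<times> (SIGMA i:{..<length (comps A)}. local_locs (comps A ! i)) \<times> {..<k} \<times> ?W \<times> ?V"
  let ?run = "\<lambda>(f, (i, l), j, w, v). Run f i l j w v"
  let ?hub = "\<lambda>(w, v). Hub w v :: ('s, 'l) seq_loc"
  let ?H = "if 0 < num_trans A then ?hub ` (?W \<times> ?V) else {}"
  have "card (?run ` ?X) \<le> card ?X"
    by (rule card_image_le) simp
  also have "\<dots> = 2 * (?l * (k * ?N))"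
    by (simp only: card_cartesian_product card_comps_locals N card_UNIV_bool card_lessThan)
  finally have run: "card (?run ` ?X) \<le> 2 * (?l * (k * ?N))" .
  have "card (?hub ` (?W \<times> ?V)) \<le> ?N"
    unfolding N[symmetric] card_cartesian_product[symmetric] by (rule card_image_le) simp
  then have hub: "card ?H \<le> (if 0 < num_trans A then ?N else 0)" by simp
  have "card (seq_locs A k) \<le> card (?run ` ?X \<union> ?H)"
    by (rule card_mono[OF _ locs_subset]) simp
  also have "\<dots> \<le> card (?run ` ?X) + card ?H" by (rule card_Un_le)
  also have "\<dots> \<le> 2 * (?l * (k * ?N)) + (if 0 < num_trans A then ?N else 0)"
    by (rule add_mono[OF run hub])
  \<comment> \<open>Hubs exist only if there is a transition; then l and k are positive and N is at
    most l * k * N.\<close>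
  also have "\<dots> \<le> 3 * (?l * (k * ?N))"
    using locals_pos False by auto
  \<comment> \<open>If S is empty, both exponents are still positive because k is, so both powers
    are 0.\<close>
  also have "?N \<le> card (shared A) ^ (2 * k)"
  proof (cases "card (shared A)")
    case (Suc m)
    show ?thesis unfolding Suc by (rule power_increasing) auto
  qed (use False in \<open>simp add: power_0_left\<close>)
  also have "?l * (k * card (shared A) ^ (2 * k)) \<le> ?l * (k ^ 2 * card (shared A) ^ (2 * k))"
    by (intro mult_le_mono order_refl) (simp add: power2_eq_square)
  finally show ?thesis by (simp add: mult.assoc)
qed simp

text \<open>The transitions are covered by five families, one for each rule. Their sizes are at most
  2, 2, 1, 1 and 2 times l * d * k * N, which sums to the constant 8.\<close>

lemma card_seq_delta:
  "card (delta (seq_pds A k)) \<le>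
     8 * (num_locals A * num_trans A * k ^ 3 * card (shared A) ^ (2 * k - 1))"
proof (cases "num_trans A = 0 \<or> k = 0")
  case True
  \<comment> \<open>Without transitions of the components, \<open>step\<close>,
    \<open>next_round\<close> and \<open>clear\<close> cannot apply, while \<open>retire\<close> and
    \<open>start\<close> involve a hub, and there is none. For k = 0 there are no locations.\<close>
  have "delta (seq_pds A k) = {}"
  proof (cases "k = 0")
    case False
    with True have d: "num_trans A = 0" by simp
    have "\<not> seq_rule A k q a q'" if "q \<in> seq_locs A k" "q' \<in> seq_locs A k" for q a q'
    proof
      assume "seq_rule A k q a q'"
      then show False using that d trans_pos by cases (auto simp: Run_in_locs Hub_in_locs)
    qed
    then show ?thesis by (auto simp: seq_pds_def)
  qed (simp add: seq_pds_def)
  then show ?thesis by simp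
next
  case False
  then have k: "0 < k" and d: "0 < num_trans A" by auto
  let ?N = "card (shared A) ^ (2 * k - 1)" and ?l = "num_locals A" and ?d = "num_trans A"
  let ?W = "vecs (shared A) (k - 1)" and ?V = "vecs (shared A) k"
  let ?L = "SIGMA i:{..<length (comps A)}. local_locs (comps A ! i)"
  let ?T = "SIGMA i:{..<length (comps A)}. comp_trans (comps A ! i)"
  let ?B = "UNIV :: bool set"
  have N: "card ?W * card ?V = ?N"
    using card_vec_pairs[of k] k by (simp add: card_cartesian_product)
  \<comment> \<open>The source location \<open>s\<close> is not tied to \<open>v ! j\<close>, so
    this image may contain more than the actual rule instances; an upper bound is enough.\<close>
  define step where "step =
    (\<lambda>(f, (i, ((s, l), a, (s', l'))), j, w, v).
      (Run f i l j w v :: ('s, 'l) seq_loc, a :: 'g act, Run f i l' j w (v[j := s']) :: ('s, 'l) seq_loc)) `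
      (?B \<times> ?T \<times> {..<k} \<times> ?W \<times> ?V)"
  define nexts where "nexts =
    (\<lambda>(f, (i, l), j, w, v).
      (Run f i l j w v :: ('s, 'l) seq_loc, Internal :: 'g act, Run f i l (Suc j) w v :: ('s, 'l) seq_loc)) `
      (?B \<times> ?L \<times> {..<k} \<times> ?W \<times> ?V)"
  define retire where "retire =
    (\<lambda>((i, l), w, v).
      (Run False i l (k - 1) w v :: ('s, 'l) seq_loc, Internal :: 'g act, Hub w v :: ('s, 'l) seq_loc)) `
      (?L \<times> ?W \<times> ?V)"
  \<comment> \<open>Indexing by transitions instead of stack symbols keeps the size of the alphabet
    out of the bound. Actions other than a push yield a harmless filler.\<close>
  define clear where "clear =
    (\<lambda>((i, (q, a, q')), w, v).
      (Hub w v :: ('s, 'l) seq_loc, (case a of Push g \<Rightarrow> Pop g | _ \<Rightarrow> Internal), Hub w v :: ('s, 'l) seq_loc)) `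
      (?T \<times> ?W \<times> ?V)"
  define start where "start =
    (\<lambda>(f, (i, l), w, v).
      (Hub w v :: ('s, 'l) seq_loc, Bot :: 'g act, Run f i l 0 w v :: ('s, 'l) seq_loc)) `
      (?B \<times> ?L \<times> ?W \<times> ?V)"
  have fin: "finite ?T" "finite ?L" by auto
  have sub: "delta (seq_pds A k) \<subseteq> step \<union> (nexts \<union> (retire \<union> (clear \<union> start)))"
  proof
    fix x assume "x \<in> delta (seq_pds A k)"
    then obtain q a q' where x: "x = (q, a, q')"
      and q: "q \<in> seq_locs A k" "q' \<in> seq_locs A k" and r: "seq_rule A k q a q'"
      by (auto simp: seq_pds_def)
    from r show "x \<in> step \<union> (nexts \<union> (retire \<union> (clear \<union> start)))"
    proof cases
      case (step v j l s' l' i f w)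
      with q have "x \<in> step" unfolding step_def x
        by (intro image_eqI[of _ _ "(f, (i, ((v ! j, l), a, (s', l'))), j, w, v)"])
          (auto simp: Run_in_locs)
      then show ?thesis by simp
    next
      case (next_round f v j w i l)
      with q have "x \<in> nexts" unfolding nexts_def x
        by (intro image_eqI[of _ _ "(f, (i, l), j, w, v)"]) (auto simp: Run_in_locs)
      then show ?thesis by simp
    next
      case (retire j i l w v)
      with q have "x \<in> retire" unfolding retire_def x
        by (intro image_eqI[of _ _ "((i, l), w, v)"]) (auto simp: Run_in_locs)
      then show ?thesis by simp
    next
      case (clear i p g p' w v)
      with q have "x \<in> clear" unfolding clear_def x
        by (intro image_eqI[of _ _ "((i, (p, Push g, p')), w, v)"]) (auto simp: Hub_in_locs)
      then show ?thesis by simp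
    next
      case (start l i w v f)
      with q have "x \<in> start" unfolding start_def x
        by (intro image_eqI[of _ _ "(f, (i, l), w, v)"]) (auto simp: Run_in_locs)
      then show ?thesis by simp
    qed
  qed
  have cards: "card step \<le> 2 * (?d * (k * ?N))" "card nexts \<le> 2 * (?l * (k * ?N))"
    "card retire \<le> ?l * ?N" "card clear \<le> ?d * ?N" "card start \<le> 2 * (?l * ?N)"
    unfolding step_def nexts_def retire_def clear_def start_def
    by (rule order_trans[OF card_image_le], use fin in simp,
        simp only: card_cartesian_product card_comps_locals card_comps_trans N
          card_UNIV_bool card_lessThan)+
  let ?X = "?l * (?d * (k * ?N))"
  have l: "1 \<le> ?l" and d1: "1 \<le> ?d" and k1: "1 \<le> k" using locals_pos[OF d] d k by auto
  have "card (delta (seq_pds A k)) \<le> card (step \<union> (nexts \<union> (retire \<union> (clear \<union> start))))"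
    by (intro card_mono sub) (use fin in \<open>simp add: step_def nexts_def retire_def clear_def start_def\<close>)
  also have "\<dots> \<le> card step + (card nexts + (card retire + (card clear + card start)))"
    by (meson add_left_mono card_Un_le order_trans)
  also have "\<dots> \<le> 2 * ?X + (2 * ?X + (?X + (?X + 2 * ?X)))"
  proof -
    have 1: "?d * (k * ?N) \<le> ?X" "?l * (k * ?N) \<le> ?X" "?l * ?N \<le> ?X" "?d * ?N \<le> ?X"
      using mult_le_mono[OF l order_refl, of "?d * (k * ?N)"]
        mult_le_mono[OF order_refl mult_le_mono[OF d1 order_refl], of ?l "k * ?N"]
        mult_le_mono[OF order_refl mult_le_mono[OF d1 mult_le_mono[OF k1 order_refl]], of ?l ?N]
        mult_le_mono[OF l mult_le_mono[OF order_refl mult_le_mono[OF k1 order_refl]], of ?d ?N]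
      by simp_all
    show ?thesis by (intro add_mono order_trans[OF cards(1)] order_trans[OF cards(2)]
      order_trans[OF cards(3)] order_trans[OF cards(4)] order_trans[OF cards(5)]) (use 1 in simp_all)
  qed
  also have "\<dots> = 8 * ?X" by simp
  also have "\<dots> \<le> 8 * (?l * (?d * (k ^ 3 * ?N)))"
    by (intro mult_le_mono order_refl) (simp add: power3_eq_cube)
  finally show ?thesis by (simp add: mult.assoc)
qed

lemma wf_seq_pds: "wf_pds (seq_pds A k)"
proof -
  have alph: "set_act a \<subseteq> (\<Union>i < length (comps A). comp_alph (comps A ! i))"
    if "seq_rule A k q a q'" "q \<in> seq_locs A k" for q a q'
    using that
  proof cases
    case (step v j l s' l' i f w)
    with that(2) have "i < length (comps A)" by (simp add: Run_in_locs)
    with transD(5)[OF this step(3)] show ?thesis by blast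
  next
    \<comment> \<open>A popped symbol is one that some transition pushes, hence it lies in the
      alphabet of a component.\<close>
    case (clear i p g p' w v)
    then have "g \<in> comp_alph (comps A ! i)"
      using transD(5)[of i "fst p" "snd p" "Push g" "fst p'" "snd p'"] by auto
    with clear show ?thesis by auto
  qed auto
  show ?thesis
    using alph by (fastforce simp: wf_pds_def seq_pds_def seq_inits_def finite_seq_locs)
qed

lemma seq_step:
  assumes "seq_rule A k q a q'" "q \<in> seq_locs A k" "q' \<in> seq_locs A k" "act_rel a st st'"
  shows "pds_step (seq_pds A k) (q, st) (q', st')"
  using assms by (auto simp: pds_step_def seq_pds_def)

lemma seq_steps_locs:
  assumes "(pds_step (seq_pds A k))\<^sup>*\<^sup>* (q, st) (q', st')" and "q \<in> seq_locs A k"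
  shows "q' \<in> seq_locs A k"
  using assms by (induction rule: rtranclp_induct2) (auto simp: pds_step_def seq_pds_def)

section \<open>Soundness\<close>

text \<open>Here \<open>u ! r\<close> is the shared location in which round \<open>r\<close> starts, \<open>cs r\<close> are the completed
  threads at that time, and \<open>h r\<close> is the thread that is currently being simulated.\<close>

fun seq_inv :: "nat \<Rightarrow> ('s, 'l) seq_loc \<Rightarrow> 'g list \<Rightarrow> bool" where
  "seq_inv k (Run f i l j w v) st \<longleftrightarrow> (\<exists>u cs h n.
     w = tl u \<and> length u = k \<and> init_config A (u ! 0, cs 0 @ [h 0]) \<and>
     (\<forall>r\<le>k. length (cs r) = n) \<and>
     (\<forall>r\<le>j. exec A [0..<Suc n] (u ! r, cs r @ [h r]) (v ! r, cs (Suc r) @ [h (Suc r)])) \<and>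
     h (Suc j) = (i, l, st) \<and>
     (\<forall>r. j < r \<and> r < k \<longrightarrow> exec A [0..<n] (u ! r, cs r) (v ! r, cs (Suc r))) \<and>
     (f \<longrightarrow> (\<forall>r<j. v ! r = w ! r)))"
| "seq_inv k (Hub w v) st \<longleftrightarrow> (\<exists>u cs n.
     w = tl u \<and> length u = k \<and> init_config A (u ! 0, cs 0) \<and>
     (\<forall>r\<le>k. length (cs r) = n) \<and>
     (\<forall>r<k. exec A [0..<n] (u ! r, cs r) (v ! r, cs (Suc r))))"

lemma seq_inv_RunI:
  assumes "w = tl u" "length u = k" "init_config A (u ! 0, cs 0 @ [h 0])"
    and "\<forall>r\<le>k. length (cs r) = n"
    and "\<And>r. r \<le> j \<Longrightarrow>
      exec A [0..<Suc n] (u ! r, cs r @ [h r]) (v ! r, cs (Suc r) @ [h (Suc r)])"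
    and "h (Suc j) = (i, l, st)"
    and "\<And>r. j < r \<Longrightarrow> r < k \<Longrightarrow> exec A [0..<n] (u ! r, cs r) (v ! r, cs (Suc r))"
    and "\<And>r. f \<Longrightarrow> r < j \<Longrightarrow> v ! r = w ! r"
  shows "seq_inv k (Run f i l j w v) st"
  unfolding seq_inv.simps
  by (rule exI[of _ u], rule exI[of _ cs], rule exI[of _ h], rule exI[of _ n])
    (use assms in \<open>simp del: upt_Suc\<close>)

lemma seq_inv_RunE:
  assumes "seq_inv k (Run f i l j w v) st"
  obtains u cs h n where
    "w = tl u" "length u = k" "init_config A (u ! 0, cs 0 @ [h 0])"
    "\<forall>r\<le>k. length (cs r) = n"
    "\<And>r. r \<le> j \<Longrightarrow>
      exec A [0..<Suc n] (u ! r, cs r @ [h r]) (v ! r, cs (Suc r) @ [h (Suc r)])"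
    "h (Suc j) = (i, l, st)"
    "\<And>r. j < r \<Longrightarrow> r < k \<Longrightarrow> exec A [0..<n] (u ! r, cs r) (v ! r, cs (Suc r))"
    "\<And>r. f \<Longrightarrow> r < j \<Longrightarrow> v ! r = w ! r"
proof -
  from assms obtain u cs h n where
    "w = tl u \<and> length u = k \<and> init_config A (u ! 0, cs 0 @ [h 0]) \<and>
     (\<forall>r\<le>k. length (cs r) = n) \<and>
     (\<forall>r\<le>j. exec A [0..<Suc n] (u ! r, cs r @ [h r]) (v ! r, cs (Suc r) @ [h (Suc r)])) \<and>
     h (Suc j) = (i, l, st) \<and>
     (\<forall>r. j < r \<and> r < k \<longrightarrow> exec A [0..<n] (u ! r, cs r) (v ! r, cs (Suc r))) \<and>
     (f \<longrightarrow> (\<forall>r<j. v ! r = w ! r))"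
    unfolding seq_inv.simps by (elim exE)
  then show thesis by (intro that[of u cs h n]) (simp_all del: upt_Suc)
qed

lemma seq_inv_init:
  assumes "q \<in> seq_inits A k"
  shows "seq_inv k q []"
proof -
  from assms obtain f i l w v where q: "q = Run f i l 0 w v" "l \<in> local_inits (comps A ! i)"
      "v ! 0 \<in> shared0 A" "w = tl v" "q \<in> seq_locs A k"
    by (auto simp: seq_inits_def)
  then have "i < length (comps A)" "length v = k" by (auto simp: Run_in_locs vecs_def)
  \<comment> \<open>The initial vector \<open>v\<close> serves as the vector of round starts; no
    thread is completed yet, and the current one is still in its initial state.\<close>
  with q show ?thesis
    by (auto simp: init_config_def exec_refl
        intro!: exI[of _ v] exI[of _ "\<lambda>_. []"] exI[of _ "\<lambda>_. (i, l, [])"])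
qed

text \<open>Each rule extends the witnessing rounds: \<open>step\<close> prolongs the current
  activation, \<open>next_round\<close> lets the current thread enter the next round idly,
  \<open>retire\<close> counts it among the completed threads, and \<open>start\<close> appends a
  fresh idle thread. \<open>clear\<close> changes nothing, as the invariant of a hub ignores the
  stack.\<close>

lemma seq_inv_step:
  assumes inv: "seq_inv k q st" and step: "pds_step (seq_pds A k) (q, st) (q', st')"
  shows "seq_inv k q' st'"
proof -
  from step obtain a where rule: "seq_rule A k q a q'" and act: "act_rel a st st'"
    and locs: "q \<in> seq_locs A k" "q' \<in> seq_locs A k"
    by (auto simp: pds_step_def seq_pds_def)
  from rule show ?thesis
  proof cases
    case (step v j l s' l' i f w)
    from inv[unfolded step(1)] show ?thesis
    proof (rule seq_inv_RunE)
      fix u cs h n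
      assume u: "w = tl u" "length u = k" "init_config A (u ! 0, cs 0 @ [h 0])"
        and cs: "\<forall>r\<le>k. length (cs r) = n"
        and past: "\<And>r. r \<le> j \<Longrightarrow>
          exec A [0..<Suc n] (u ! r, cs r @ [h r]) (v ! r, cs (Suc r) @ [h (Suc r)])"
        and h: "h (Suc j) = (i, l, st)"
        and future: "\<And>r. j < r \<Longrightarrow> r < k \<Longrightarrow>
          exec A [0..<n] (u ! r, cs r) (v ! r, cs (Suc r))"
        and f: "\<And>r. f \<Longrightarrow> r < j \<Longrightarrow> v ! r = w ! r"
      have j: "j < k" "length v = k" using locs step by (auto simp: Run_in_locs vecs_def)
      have n: "length (cs (Suc j)) = n" using cs j by simp
      \<comment> \<open>\<open>h (Suc j)\<close> is the state of the thread at the end of round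
        \<open>j\<close>, the only state that the step changes. The thread has index
        \<open>n\<close>, after the \<open>n\<close> completed ones.\<close>
      define h' where "h' = h(Suc j := (i, l', st'))"
      have "thread_step A n (v ! j, cs (Suc j) @ [h (Suc j)]) (s', cs (Suc j) @ [h' (Suc j)])"
        using step(3) act n
        by (auto simp: thread_step_def h h'_def pds_step_def comp_pds_def nth_append
            list_update_append)
      from exec_snoc_step[OF past[OF order_refl, unfolded upt_Suc_append[OF le0]] this]
      have now: "exec A [0..<Suc n] (u ! j, cs j @ [h j]) (s', cs (Suc j) @ [h' (Suc j)])"
        unfolding upt_Suc_append[OF le0] .
      show ?thesis unfolding step(2)
      proof (rule seq_inv_RunI[OF u(1,2) _ cs])
        show "exec A [0..<Suc n] (u ! r, cs r @ [h' r])
            (v[j := s'] ! r, cs (Suc r) @ [h' (Suc r)])" if "r \<le> j" for r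
          using that past[of r] now j
          by (cases "r = j") (simp_all add: h'_def del: upt_Suc)
        show "exec A [0..<n] (u ! r, cs r) (v[j := s'] ! r, cs (Suc r))"
          if "j < r" "r < k" for r using that future by simp
        show "init_config A (u ! 0, cs 0 @ [h' 0])" "h' (Suc j) = (i, l', st')"
          using u(3) by (simp_all add: h'_def)
        show "v[j := s'] ! r = w ! r" if f "r < j" for r using f that by simp
      qed
    qed
  next
    case (next_round f v j w i l)
    from inv[unfolded next_round(1)] show ?thesis
    proof (rule seq_inv_RunE)
      fix u cs h n
      assume u: "w = tl u" "length u = k" "init_config A (u ! 0, cs 0 @ [h 0])"
        and cs: "\<forall>r\<le>k. length (cs r) = n"
        and past: "\<And>r. r \<le> j \<Longrightarrow>
          exec A [0..<Suc n] (u ! r, cs r @ [h r]) (v ! r, cs (Suc r) @ [h (Suc r)])"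
        and h: "h (Suc j) = (i, l, st)"
        and future: "\<And>r. j < r \<Longrightarrow> r < k \<Longrightarrow>
          exec A [0..<n] (u ! r, cs r) (v ! r, cs (Suc r))"
        and f: "\<And>r. f \<Longrightarrow> r < j \<Longrightarrow> v ! r = w ! r"
      have j: "Suc j < k" using locs next_round by (simp add: Run_in_locs)
      have st: "st' = st" using act next_round by simp
      define h' where "h' = h(Suc (Suc j) := (i, l, st))"
      have now: "exec A [0..<Suc n] (u ! Suc j, cs (Suc j) @ [(i, l, st)])
          (v ! Suc j, cs (Suc (Suc j)) @ [(i, l, st)])"
        by (rule exec_new_thread[OF future[OF lessI j]])
      show ?thesis unfolding next_round(3) st
      proof (rule seq_inv_RunI[OF u(1,2) _ cs])
        show "exec A [0..<Suc n] (u ! r, cs r @ [h' r])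
            (v ! r, cs (Suc r) @ [h' (Suc r)])" if "r \<le> Suc j" for r
          using that past[of r] now h
          by (cases "r = Suc j") (simp_all add: h'_def del: upt_Suc)
        show "exec A [0..<n] (u ! r, cs r) (v ! r, cs (Suc r))"
          if "Suc j < r" "r < k" for r using that future by simp
        show "init_config A (u ! 0, cs 0 @ [h' 0])" "h' (Suc (Suc j)) = (i, l, st)"
          using u(3) by (simp_all add: h'_def)
        \<comment> \<open>The only new case is \<open>r = j\<close>, which is the check made by the
          rule when the last thread leaves round \<open>j\<close>.\<close>
        show "v ! r = w ! r" if f "r < Suc j" for r
          using f that next_round(5) by (auto simp: less_Suc_eq)
      qed
    qed
  next
    case (retire j i l w v)
    from inv[unfolded retire(1)] show ?thesis
    proof (rule seq_inv_RunE)
      fix u cs h n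
      assume "w = tl u" "length u = k" "init_config A (u ! 0, cs 0 @ [h 0])"
        and "\<forall>r\<le>k. length (cs r) = n"
        and "\<And>r. r \<le> j \<Longrightarrow>
          exec A [0..<Suc n] (u ! r, cs r @ [h r]) (v ! r, cs (Suc r) @ [h (Suc r)])"
      \<comment> \<open>As \<open>Suc j = k\<close>, the current thread has taken part in all
        \<open>k\<close> rounds and can join the completed ones.\<close>
      then show ?thesis unfolding retire(3) seq_inv.simps
        by (intro exI[of _ u] exI[of _ "\<lambda>r. cs r @ [h r]"] exI[of _ "Suc n"])
          (simp add: retire(4)[symmetric] del: upt_Suc)
    qed
  next
    case (clear i p g p' w v)
    with inv show ?thesis by simp
  next
    case (start l i w v f)
    from inv[unfolded start(1)] obtain u cs n where
      u: "w = tl u" "length u = k" "init_config A (u ! 0, cs 0)"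
      and cs: "\<forall>r\<le>k. length (cs r) = n"
      and rounds: "\<forall>r<k. exec A [0..<n] (u ! r, cs r) (v ! r, cs (Suc r))"
      by auto
    have i: "i < length (comps A)" "0 < k" using locs start by (auto simp: Run_in_locs)
    have st: "st' = []" using act start by simp
    show ?thesis unfolding start(3) st
    proof (rule seq_inv_RunI[OF u(1,2) _ cs])
      show "init_config A (u ! 0, cs 0 @ [(i, l, [])])"
        using u(3) i start(4) by (auto simp: init_config_def)
      show "exec A [0..<Suc n] (u ! r, cs r @ [(i, l, [])]) (v ! r, cs (Suc r) @ [(i, l, [])])"
        if "r \<le> 0" for r
        by (rule exec_new_thread) (use rounds i that in simp)
    qed (use rounds in auto)
  qed
qed

lemma concat_replicate_Suc: "concat (replicate (Suc r) xs) = concat (replicate r xs) @ xs"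
  by (induction r) auto

lemma concat_replicate_add:
  "concat (replicate (a + b) xs) = concat (replicate a xs) @ concat (replicate b xs)"
  by (simp add: replicate_add)

text \<open>Since the flag is set, the guesses for the rounds before \<open>j\<close> have been
  confirmed, so these rounds and the current one join into a genuine run. Later rounds need not fit
  together: they follow the visit and enter only as the remainder of the schedule.\<close>

lemma seq_sound:
  assumes "pds_reachable (seq_pds A k) (seq_target A k i s l)"
  shows "k_round_reachable A k i s l"
proof -
  from assms obtain q0 j w v st where q0: "q0 \<in> seq_inits A k"
    and reach: "(pds_step (seq_pds A k))\<^sup>*\<^sup>* (q0, []) (Run True i l j w v, st)"
    and target: "Run True i l j w v \<in> seq_locs A k" "v ! j = s"
    by (auto simp: pds_reachable_def seq_target_def seq_pds_def)
  from reach have "seq_inv k (Run True i l j w v) st"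
    by (induction rule: rtranclp_induct2) (auto simp only: seq_inv_init[OF q0] intro: seq_inv_step)
  then show ?thesis
  proof (rule seq_inv_RunE)
    fix u cs h n
    assume u: "w = tl u" "length u = k" "init_config A (u ! 0, cs 0 @ [h 0])"
      and cs: "\<forall>r\<le>k. length (cs r) = n"
      and past: "\<And>r. r \<le> j \<Longrightarrow>
        exec A [0..<Suc n] (u ! r, cs r @ [h r]) (v ! r, cs (Suc r) @ [h (Suc r)])"
      and h: "h (Suc j) = (i, l, st)"
      and guess: "\<And>r. True \<Longrightarrow> r < j \<Longrightarrow> v ! r = w ! r"
    have j: "j < k" using target by (simp add: Run_in_locs)
    let ?O = "[0..<Suc n]"
    let ?c0 = "(u ! 0, cs 0 @ [h 0])"
    have "r \<le> j \<Longrightarrow> exec A (concat (replicate r ?O)) ?c0 (u ! r, cs r @ [h r])" for r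
    proof (induction r)
      case (Suc r)
      \<comment> \<open>The guessed vector is \<open>tl u\<close>, so a confirmed guess says that
        round \<open>r\<close> ends where round \<open>Suc r\<close> starts.\<close>
      moreover have "v ! r = u ! Suc r" using guess Suc.prems j u by (simp add: nth_tl)
      ultimately show ?case using past[of r] unfolding concat_replicate_Suc exec_append
        by (intro exI[of _ "(u ! r, cs r @ [h r])"]) simp
    qed simp
    then have pre: "exec A (concat (replicate j ?O)) ?c0 (u ! j, cs j @ [h j])" by simp
    have "exec A ([0..<n] @ [n]) (u ! j, cs j @ [h j]) (s, cs (Suc j) @ [(i, l, st)])"
      using past[OF order_refl] unfolding h target(2) upt_Suc_append[OF le0] .
    then obtain c where c: "exec A [0..<n] (u ! j, cs j @ [h j]) c"
        "(thread_step A n)\<^sup>*\<^sup>* c (s, cs (Suc j) @ [(i, l, st)])"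
      by (auto simp only: exec_append exec_Cons_iff exec_Nil_iff)
    have "concat (replicate k ?O) =
        concat (replicate j ?O) @ ?O @ concat (replicate (k - Suc j) ?O)"
      using concat_replicate_add[of "Suc j" "k - Suc j" ?O] j
      by (simp only: concat_replicate_Suc append_assoc) simp
    then have "k_round_schedule (length (snd ?c0)) k
        ((concat (replicate j ?O) @ [0..<n]) @ n # concat (replicate (k - Suc j) ?O))"
      unfolding k_round_schedule_def using cs by (intro exI[of _ ?O]) auto
    moreover have "exec A (concat (replicate j ?O) @ [0..<n]) ?c0 c"
      using pre c(1) exec_append by blast
    moreover have "(cs (Suc j) @ [(i, l, st)]) ! n = (i, l, st)"
      using cs j by (simp add: nth_append)
    ultimately show ?thesis unfolding k_round_reachable_def using u(3) c(2) by blast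
  qed
qed

section \<open>Completeness\<close>

lemma run_sim:
  assumes "(pds_step (comp_pds A i))\<^sup>*\<^sup>* ((s, l), st) ((s', l'), st')"
    and "Run f i l j w x \<in> seq_locs A k" "x ! j = s"
  shows "(pds_step (seq_pds A k))\<^sup>*\<^sup>* (Run f i l j w x, st) (Run f i l' j w (x[j := s']), st') \<and>
    Run f i l' j w (x[j := s']) \<in> seq_locs A k"
  using assms(1)
proof (induction "((s', l'), st')" arbitrary: s' l' st' rule: rtranclp_induct)
  case base
  then show ?case using assms by auto
next
  case (step y)
  obtain s1 l1 st1 where y: "y = ((s1, l1), st1)" by (metis prod.exhaust)
  note IH = step.hyps(3)[OF y]
  let ?q1 = "Run f i l1 j w (x[j := s1])" and ?q2 = "Run f i l' j w (x[j := s'])"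
  have q1: "i < length (comps A)" "j < k" "length x = k"
    using IH by (auto simp: Run_in_locs vecs_def)
  from step.hyps(2) y obtain a where a: "((s1, l1), a, (s', l')) \<in> comp_trans (comps A ! i)"
      "act_rel a st1 st'"
    by (auto simp: pds_step_def comp_pds_def)
  have "?q2 \<in> seq_locs A k"
    using assms(2) q1 transD[OF q1(1) a(1)] set_update_subset_insert[of x j s']
    by (auto simp: Run_in_locs vecs_def)
  moreover have "seq_rule A k ?q1 a ?q2"
    using seq_rule.step[of "x[j := s1]" j l1 a s' l' A i k f w] a(1) q1 by simp
  ultimately have "pds_step (seq_pds A k) (?q1, st1) (?q2, st')"
    using IH a(2) by (intro seq_step) auto
  with IH \<open>?q2 \<in> _\<close> show ?case by (meson rtranclp.rtrancl_into_rtrancl)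
qed

text \<open>After round \<open>j\<close> the entries up to \<open>j\<close> hold the locations in
  which the thread leaves its rounds, while the later ones still hold those in which it enters them.
  This mixture is the vector in the conclusion.\<close>

lemma thread_sim:
  assumes d: "0 < num_trans A"
    and start: "Run f i (l 0) 0 w u \<in> seq_locs A k" and v: "length v = k"
    and runs: "\<And>r. r < k \<Longrightarrow>
      (pds_step (comp_pds A i))\<^sup>*\<^sup>* ((u ! r, l r), st r) ((v ! r, l (Suc r)), st (Suc r))"
    and f: "\<And>r. f \<Longrightarrow> Suc r < k \<Longrightarrow> v ! r = w ! r"
    and "j < k"
  shows "(pds_step (seq_pds A k))\<^sup>*\<^sup>* (Run f i (l 0) 0 w u, st 0)
      (Run f i (l (Suc j)) j w (take (Suc j) v @ drop (Suc j) u), st (Suc j)) \<and>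
    Run f i (l (Suc j)) j w (take (Suc j) v @ drop (Suc j) u) \<in> seq_locs A k"
  using \<open>j < k\<close>
proof (induction j)
  let ?X = "\<lambda>j. take j v @ drop j u"
  have u: "length u = k" using start by (simp add: Run_in_locs vecs_def)
  have X: "(?X j)[j := v ! j] = ?X (Suc j)" "?X j ! j = u ! j" if "j < k" for j
    using that u v by (auto simp: nth_append list_update_append upd_conv_take_nth_drop
        take_Suc_conv_app_nth Cons_nth_drop_Suc[symmetric])
  {
    case 0
    then show ?case using run_sim[OF runs[OF 0] start] X[OF 0] by auto
  next
    case (Suc j)
    let ?q = "Run f i (l (Suc j)) j w (?X (Suc j))" and ?q' = "Run f i (l (Suc j)) (Suc j) w (?X (Suc j))"
    from Suc have IH: "(pds_step (seq_pds A k))\<^sup>*\<^sup>* (Run f i (l 0) 0 w u, st 0) (?q, st (Suc j))"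
        "?q \<in> seq_locs A k" by auto
    have q': "?q' \<in> seq_locs A k" using IH(2) Suc.prems by (auto simp: Run_in_locs)
    have "?X (Suc j) ! j = v ! j" using Suc.prems v by (simp add: nth_append)
    then have "seq_rule A k ?q Internal ?q'"
      using f Suc.prems by (intro next_round[OF d]) auto
    then have "pds_step (seq_pds A k) (?q, st (Suc j)) (?q', st (Suc j))"
      using IH q' by (intro seq_step) auto
    moreover note run_sim[OF runs[OF Suc.prems] q' X(2)[OF Suc.prems]]
    ultimately show ?case using IH(1) X(1)[OF Suc.prems]
      by (metis (no_types, lifting) rtranclp.rtrancl_into_rtrancl rtranclp_trans)
  }
qed

text \<open>A hub pops only symbols that occur in push transitions. This shows that these are the
  only symbols a thread with an initially empty stack can leave behind.\<close>

lemma stack_pushed: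
  assumes "(pds_step (comp_pds A i))\<^sup>*\<^sup>* (q, st0) (q', st)" and "g \<in> set st"
  shows "g \<in> set st0 \<or> (\<exists>p p'. (p, Push g, p') \<in> comp_trans (comps A ! i))"
  using assms
proof (induction "(q', st)" arbitrary: q' st rule: rtranclp_induct)
  case (step y)
  obtain q1 st1 where y: "y = (q1, st1)" by fastforce
  from step.hyps(2) y obtain a where a: "(q1, a, q') \<in> comp_trans (comps A ! i)" "act_rel a st1 st"
    by (auto simp: pds_step_def comp_pds_def)
  have "g \<in> set st1 \<or> a = Push g" using a(2) step.prems by (cases a) auto
  then show ?case using step.hyps(3)[OF y] a(1) by blast
qed auto

lemma clear_stack:
  assumes "Hub w v \<in> seq_locs A k" "i < length (comps A)"
    and "\<And>g. g \<in> set st \<Longrightarrow> \<exists>p p'. (p, Push g, p') \<in> comp_trans (comps A ! i)"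
  shows "(pds_step (seq_pds A k))\<^sup>*\<^sup>* (Hub w v, st) (Hub w v, [])"
  using assms(3)
proof (induction st)
  case (Cons g st)
  then obtain p p' where "(p, Push g, p') \<in> comp_trans (comps A ! i)" by fastforce
  then have "pds_step (seq_pds A k) (Hub w v, g # st) (Hub w v, st)"
    using assms by (intro seq_step[OF clear]) auto
  with Cons show ?case by (meson converse_rtranclp_into_rtranclp list.set_intros(2))
qed simp

text \<open>Induction on the list \<open>xs\<close> of threads still to be simulated.
  \<open>u\<close> holds the shared locations in which the head of \<open>xs\<close> is entered,
  \<open>cs r\<close> the threads at that moment of round \<open>r\<close>, and \<open>v\<close> and
  \<open>cs' r\<close> describe the ends of the rounds, which stay fixed along with the guess
  \<open>w\<close>.\<close>

lemma sequentialize: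
  assumes pos: "0 < num_trans A" and k: "0 < k"
    and "xs \<noteq> []" "distinct xs" "length v = k"
    and "\<And>r. r < k \<Longrightarrow> exec A xs (u ! r, cs r) (v ! r, cs' r)"
    and "\<And>r t. Suc r < k \<Longrightarrow> t \<in> set xs \<Longrightarrow> cs' r ! t = cs (Suc r) ! t"
    and "\<And>t. t \<in> set xs \<Longrightarrow>
      \<exists>i l. cs 0 ! t = (i, l, []) \<and> i < length (comps A) \<and> l \<in> local_inits (comps A ! i)"
    and "u \<in> vecs (shared A) k" and w: "w \<in> vecs (shared A) (k - 1)"
    and guess: "\<And>r. Suc r < k \<Longrightarrow> v ! r = w ! r"
    and "cs 0 ! hd xs = (i, l, [])" and "f \<longleftrightarrow> tl xs = []"
    and "cs' (k - 1) ! last xs = (i', l', st')"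
  shows "(pds_step (seq_pds A k))\<^sup>*\<^sup>* (Run f i l 0 w u, []) (Run True i' l' (k - 1) w v, st')"
  using assms(3-9,12-14)
proof (induction xs arbitrary: u cs i l f)
  case (Cons x xs)
  have x: "x \<notin> set xs" "distinct xs" using Cons.prems(2) by auto
  \<comment> \<open>\<open>d r\<close> is the configuration of round \<open>r\<close> between the
    activation of \<open>x\<close> and those of the remaining threads.\<close>
  have "\<forall>r\<in>{..<k}. \<exists>d. (thread_step A x)\<^sup>*\<^sup>* (u ! r, cs r) d \<and> exec A xs d (v ! r, cs' r)"
    using Cons.prems(4) unfolding exec_Cons_iff by simp
  from bchoice[OF this] obtain d where
    d: "\<forall>r\<in>{..<k}. (thread_step A x)\<^sup>*\<^sup>* (u ! r, cs r) (d r) \<and> exec A xs (d r) (v ! r, cs' r)" ..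
  define y where "y r = fst (d r)" for r
  define ds where "ds r = snd (d r)" for r
  have yds: "(thread_step A x)\<^sup>*\<^sup>* (u ! r, cs r) (y r, ds r)"
    "exec A xs (y r, ds r) (v ! r, cs' r)" if "r < k" for r
    using d that by (simp_all add: y_def ds_def)
  \<comment> \<open>The state of \<open>x\<close> on entering round \<open>r\<close>. At
    \<open>r = k\<close> there is no further round, so the state after the last activation of
    \<open>x\<close> is taken.\<close>
  define h where "h r = (if r < k then cs r ! x else ds (k - 1) ! x)" for r
  have ds_x: "ds r ! x = h (Suc r)" if "r < k" for r
  proof (cases "Suc r < k")
    \<comment> \<open>The activations of \<open>xs\<close> do not touch \<open>x\<close>, so its
      state survives until the next round.\<close>
    case True
    have "ds r ! x = cs' r ! x" using exec_other[OF yds(2)[OF that] x(1)] by simp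
    then show ?thesis using Cons.prems(5)[OF True] True by (simp add: h_def)
  next
    case False
    with that have "r = k - 1" by simp
    with False show ?thesis by (simp add: h_def)
  qed
  obtain i\<^sub>0 l\<^sub>0 where "cs 0 ! x = (i\<^sub>0, l\<^sub>0, [])" "i\<^sub>0 < length (comps A)"
      "l\<^sub>0 \<in> local_inits (comps A ! i\<^sub>0)"
    using Cons.prems(6)[of x] by auto
  then have h0: "h 0 = (i, l, [])" and i: "i < length (comps A)" "l \<in> local_inits (comps A ! i)"
    using Cons.prems(8) k by (auto simp: h_def)
  have one: "\<exists>l2 st2. (pds_step (comp_pds A i))\<^sup>*\<^sup>* ((u ! r, l1), st1) ((y r, l2), st2) \<and>
      h (Suc r) = (i, l2, st2)"
    if r: "r < k" and hr: "h r = (i, l1, st1)" for r l1 st1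
  proof -
    have "cs r ! x = (i, l1, st1)" using hr r by (simp add: h_def)
    from thread_steps_pds[OF yds(1)[OF r] this] obtain l2 st2 where
      *: "(pds_step (comp_pds A i))\<^sup>*\<^sup>* ((u ! r, l1), st1) ((y r, l2), st2)"
        "ds r = (cs r)[x := (i, l2, st2)]" .
    show ?thesis
    \<comment> \<open>An index out of range permits no step; the value read there is then the same
      before and after.\<close>
    proof (cases "x < length (cs r)")
      case True
      with *(2) ds_x[OF r, symmetric] have "h (Suc r) = (i, l2, st2)" by simp
      with *(1) show ?thesis by blast
    next
      case False
      have "\<not> thread_step A x (u ! r, cs r) c" for c using False by (auto simp: thread_step_def)
      then have "y r = u ! r" "ds r = cs r"
        using yds(1)[OF r] by (auto elim: converse_rtranclpE)
      with \<open>cs r ! x = _\<close> ds_x[OF r, symmetric] have "h (Suc r) = (i, l1, st1)" by simp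
      with \<open>y r = u ! r\<close> show ?thesis by (intro exI[of _ l1] exI[of _ st1]) simp
    qed
  qed
  define L where "L r = fst (snd (h r))" for r
  define S where "S r = snd (snd (h r))" for r
  have hLS: "r \<le> k \<Longrightarrow> h r = (i, L r, S r)" for r
  proof (induction r)
    case 0
    then show ?case by (simp add: h0 L_def S_def)
  next
    case (Suc r)
    then show ?case using one[of r "L r" "S r"] by (auto simp: L_def S_def)
  qed
  \<comment> \<open>The locations in which \<open>x\<close> leaves its rounds are those in which its
    successor enters them.\<close>
  let ?y = "map y [0..<k]"
  have runs: "(pds_step (comp_pds A i))\<^sup>*\<^sup>* ((u ! r, L r), S r) ((?y ! r, L (Suc r)), S (Suc r))"
    if "r < k" for r
    using one[OF that hLS] hLS[of "Suc r"] that by auto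
  have L0: "L 0 = l" "S 0 = []" by (simp_all add: L_def S_def h0)
  have start: "Run f i (L 0) 0 w u \<in> seq_locs A k"
    using i k Cons.prems(7) w init_local by (simp add: Run_in_locs L0)
  have u: "length u = k" using Cons.prems(7) by (simp add: vecs_def)
  have f: "?y ! r = w ! r" if "f" "Suc r < k" for r
  proof -
    have "xs = []" using that Cons.prems(9) by simp
    then have "y r = v ! r" using yds(2)[of r] that by simp
    then show ?thesis using guess that by simp
  qed
  have yk: "take (Suc (k - 1)) ?y @ drop (Suc (k - 1)) u = ?y" "Suc (k - 1) = k"
    using u k by auto
  have sim: "(pds_step (seq_pds A k))\<^sup>*\<^sup>* (Run f i l 0 w u, []) (Run f i (L k) (k - 1) w ?y, S k)"
      "Run f i (L k) (k - 1) w ?y \<in> seq_locs A k"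
    using thread_sim[OF pos start _ runs f, of "k - 1"] k u unfolding yk L0 by auto
  show ?case
  proof (cases "xs = []")
    case True
    then have "f" using Cons.prems(9) by simp
    have yv: "y r = v ! r" "ds r = cs' r" if "r < k" for r using yds(2)[OF that] True by auto
    then have "?y = v" using Cons.prems(3) by (auto intro: nth_equalityI)
    moreover have "(i, L k, S k) = (i', l', st')"
      using hLS[of k] ds_x[of "k - 1"] yv[of "k - 1"] Cons.prems(10) True k by simp
    ultimately show ?thesis using sim \<open>f\<close> by simp
  next
    case False
    then have "\<not> f" using Cons.prems(9) by simp
    obtain i2 l2 where i2: "cs 0 ! hd xs = (i2, l2, [])" "i2 < length (comps A)"
        "l2 \<in> local_inits (comps A ! i2)"
      using Cons.prems(6)[of "hd xs"] False by auto
    let ?f = "tl xs = []"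
    have yV: "?y \<in> vecs (shared A) k" using sim(2) by (simp add: Run_in_locs)
    have hub: "Hub w ?y \<in> seq_locs A k" using pos k w yV by (simp add: Hub_in_locs)
    have q2: "Run ?f i2 l2 0 w ?y \<in> seq_locs A k"
      using i2 k w yV init_local by (simp add: Run_in_locs)
    have pushed: "\<exists>p p'. (p, Push g, p') \<in> comp_trans (comps A ! i)" if "g \<in> set (S r)" "r \<le> k" for g r
      using that
    proof (induction r)
      case 0
      then show ?case by (simp add: L0)
    next
      case (Suc r)
      then have "r < k" by simp
      from stack_pushed[OF runs[OF this] Suc.prems(1)] Suc show ?case by auto
    qed
    have "seq_rule A k (Run f i (L k) (k - 1) w ?y) Internal (Hub w ?y)"
      using \<open>\<not> f\<close> k by (simp add: retire)
    then have "pds_step (seq_pds A k) (Run f i (L k) (k - 1) w ?y, S k) (Hub w ?y, S k)"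
      using sim(2) hub by (rule seq_step) simp
    note rtranclp.rtrancl_into_rtrancl[OF sim(1) this]
    also have "(pds_step (seq_pds A k))\<^sup>*\<^sup>* (Hub w ?y, S k) (Hub w ?y, [])"
      using clear_stack[OF hub i(1)] pushed by blast
    also have "pds_step (seq_pds A k) (Hub w ?y, []) (Run ?f i2 l2 0 w ?y, [])"
      using i2 hub q2 by (intro seq_step[OF seq_rule.start]) auto
    also have "(pds_step (seq_pds A k))\<^sup>*\<^sup>* (Run ?f i2 l2 0 w ?y, []) (Run True i' l' (k - 1) w v, st')"
    \<comment> \<open>The activation of \<open>x\<close> leaves the threads in \<open>xs\<close> as
      they were, so the assumptions on \<open>cs\<close> carry over to \<open>ds\<close>.\<close>
    proof (rule Cons.IH[where cs = ds])
      have other: "ds r ! t = cs r ! t" if "r < k" "t \<in> set xs" for r t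
        using thread_steps_other[OF yds(1)[OF that(1)], of t] that x by auto
      show "exec A xs (?y ! r, ds r) (v ! r, cs' r)" if "r < k" for r using yds(2) that by simp
      show "cs' r ! t = ds (Suc r) ! t" if "Suc r < k" "t \<in> set xs" for r t
        using that Cons.prems(5)[of r t] other by simp
      show "\<exists>i l. ds 0 ! t = (i, l, []) \<and> i < length (comps A) \<and> l \<in> local_inits (comps A ! i)"
        if "t \<in> set xs" for t using that Cons.prems(6)[of t] other[OF k] by simp
      show "ds 0 ! hd xs = (i2, l2, [])" using i2 other[OF k] False by simp
      show "cs' (k - 1) ! last xs = (i', l', st')" using Cons.prems(10) False by simp
    qed (use False x Cons.prems(3) yV in auto)
    finally show ?thesis .
  qed
qed simp

section \<open>Rotating the ordering of the threads\<close>

lemma split_replicate: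
  assumes "us @ t # vs = concat (replicate k xs)"
  shows "\<exists>a ys zs. a < k \<and> xs = ys @ t # zs \<and> us = concat (replicate a xs) @ ys"
  using assms
proof (induction k arbitrary: us)
  case (Suc k)
  then have "us @ t # vs = xs @ concat (replicate k xs)" by simp
  then consider us' where "us = xs @ us'" "us' @ t # vs = concat (replicate k xs)"
    | zs where "xs = us @ t # zs"
    by (auto simp: append_eq_append_conv2 Cons_eq_append_conv) 
  then show ?case
  proof cases
    case 1
    from Suc.IH[OF this(2)] obtain a ys zs where "a < k" "xs = ys @ t # zs"
        "us' = concat (replicate a xs) @ ys" by auto
    with 1(1) show ?thesis by (intro exI[of _ "Suc a"]) auto
  next
    case 2
    then show ?thesis by (intro exI[of _ 0]) auto
  qed
qed simp

text \<open>Rotating the ordering so that the observed thread comes last turns the activations up to the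
  visit into a suffix of \<open>k\<close> full rounds; the missing activations at the front are idle.\<close>

lemma rotate_schedule:
  assumes "us @ t # vs = concat (replicate k xs)"
  shows "\<exists>pre ys zs. xs = ys @ t # zs \<and>
    pre @ us @ [t] = concat (replicate k (zs @ ys @ [t]))"
proof -
  obtain a ys zs where a: "a < k" "xs = ys @ t # zs" "us = concat (replicate a xs) @ ys"
    using split_replicate[OF assms] by auto
  let ?O = "zs @ ys @ [t]"
  \<comment> \<open>The \<open>a\<close> complete old rounds, with \<open>zs\<close> before and the
    started round after them, regroup into \<open>Suc a\<close> rotated rounds. As
    \<open>a < k\<close>, this does not exceed \<open>k\<close>.\<close>
  have "zs @ concat (replicate a (ys @ t # zs)) @ ys @ [t] = concat (replicate (Suc a) ?O)"
    by (induction a) auto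
  with a have "concat (replicate (k - Suc a) ?O) @ zs @ us @ [t] = concat (replicate k ?O)"
    using concat_replicate_add[of "k - Suc a" "Suc a" ?O] by simp
  with a(2) show ?thesis by (metis append_assoc)
qed

section \<open>Cutting a run into rounds and assembling the sequential run\<close>

lemma exec_rounds:
  assumes "exec A (concat (replicate k xs)) c c'"
  shows "\<exists>C. C 0 = c \<and> C k = c' \<and> (\<forall>r<k. exec A xs (C r) (C (Suc r)))"
  using assms
proof (induction k arbitrary: c')
  case (Suc k)
  then obtain d where d: "exec A (concat (replicate k xs)) c d" "exec A xs d c'"
    unfolding concat_replicate_Suc exec_append by auto
  from Suc.IH[OF d(1)] obtain C where "C 0 = c" "C k = d" "\<forall>r<k. exec A xs (C r) (C (Suc r))"
    by auto
  with d(2) show ?case by (intro exI[of _ "C(Suc k := c')"]) (auto simp: less_Suc_eq)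
qed auto

definition valid :: "('s, 'l, 'g) config \<Rightarrow> bool" where
  "valid c \<longleftrightarrow> fst c \<in> shared A \<and> (\<forall>(i, _) \<in> set (snd c). i < length (comps A))"

lemma valid_thread_step:
  assumes "thread_step A t c c'" "valid c"
  shows "valid c' \<and> 0 < num_trans A"
proof -
  from assms(1) obtain s ths s' i l st l' st' a where c: "c = (s, ths)"
      "c' = (s', ths[t := (i, l', st')])" "t < length ths" "ths ! t = (i, l, st)"
      "((s, l), a, (s', l')) \<in> comp_trans (comps A ! i)"
    by (cases c; cases c') (auto simp: thread_step_def pds_step_def comp_pds_def)
  have "(i, l, st) \<in> set ths" using c(3,4) nth_mem by metis
  then have i: "i < length (comps A)" using c(1) assms(2) by (auto simp: valid_def)
  with c assms(2) transD(3)[OF i c(5)] trans_pos[OF i c(5)] show ?thesis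
    using set_update_subset_insert[of ths t "(i, l', st')"] by (auto simp: valid_def)
qed

text \<open>The alternative in the conclusion singles out the degenerate case: without transitions a
  run never leaves its first configuration.\<close>

lemma valid_exec:
  assumes "exec A ts c c'" "valid c"
  shows "valid c' \<and> (c' = c \<or> 0 < num_trans A)"
  using assms
proof (induction rule: exec.induct)
  case (exec_Cons t c c' ts c'')
  from exec_Cons.hyps(1) exec_Cons.prems have "valid c' \<and> (c' = c \<or> 0 < num_trans A)"
    by (induction rule: rtranclp_induct) (auto dest: valid_thread_step)
  with exec_Cons show ?case by auto
qed auto

lemma seq_reachableI:
  assumes "q \<in> seq_inits A k" "q' \<in> T" "(pds_step (seq_pds A k))\<^sup>*\<^sup>* (q, []) (q', st)"
  shows "pds_reachable (seq_pds A k) T"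
proof -
  have "q \<in> inits (seq_pds A k)" using assms(1) by (simp add: seq_pds_def)
  with assms(2,3) show ?thesis unfolding pds_reachable_def by blast
qed

text \<open>The rotated run consists of \<open>k\<close> full rounds ending with the visit. Guessing
  its true round starts makes every check of the last thread succeed.\<close>

lemma seq_complete:
  assumes "k_round_reachable A k i s l"
  shows "pds_reachable (seq_pds A k) (seq_target A k i s l)"
proof -
  from assms obtain c0 us t vs c ths st order where init: "init_config A c0"
    and order: "distinct order" "set order = {..<length (snd c0)}"
      "us @ t # vs = concat (replicate k order)"
    and exec: "exec A us c0 c" "(thread_step A t)\<^sup>*\<^sup>* c (s, ths)" "ths ! t = (i, l, st)"
    by (auto simp: k_round_reachable_def k_round_schedule_def)
  have k: "0 < k" using order(3) by (cases k) auto
  obtain s0 ths0 where c0: "c0 = (s0, ths0)" by fastforce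
  obtain pre ys zs where ord: "order = ys @ t # zs"
    and sched: "pre @ us @ [t] = concat (replicate k (zs @ ys @ [t]))"
    using rotate_schedule[OF order(3)] by blast
  let ?O = "zs @ ys @ [t]"
  have O: "distinct ?O" "set ?O = {..<length ths0}"
    using order ord c0 by auto
  have inits: "\<exists>i l. ths0 ! t = (i, l, []) \<and> i < length (comps A) \<and> l \<in> local_inits (comps A ! i)"
    if "t \<in> set ?O" for t
  proof -
    obtain i l st where eq: "ths0 ! t = (i, l, st)" by (rule prod_cases3)
    then have "(i, l, st) \<in> set ths0" using that O(2) by (metis lessThan_iff nth_mem)
    then show ?thesis unfolding eq using init by (auto simp: init_config_def c0)
  qed
  have s0: "s0 \<in> shared0 A" using init by (simp add: init_config_def c0)
  have "valid c0" using init by (auto simp: valid_def init_config_def c0 shared0_shared)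
  have "exec A (us @ [t]) c0 (s, ths)"
    unfolding exec_append exec_Cons_iff exec_Nil_iff using exec(1,2) by blast
  then have ex: "exec A (concat (replicate k ?O)) c0 (s, ths)"
    unfolding sched[symmetric] exec_append[of A pre] using exec_refl by blast
  obtain C where C: "C 0 = c0" "C k = (s, ths)" "\<And>r. r < k \<Longrightarrow> exec A ?O (C r) (C (Suc r))"
    using exec_rounds[OF ex] by blast
  have CV: "r \<le> k \<Longrightarrow> valid (C r)" for r
  proof (induction r)
    case 0
    then show ?case using C(1) \<open>valid c0\<close> by simp
  next
    case (Suc r)
    then show ?case using valid_exec[OF C(3)[of r]] by simp
  qed
  \<comment> \<open>Shared locations at the starts and at the ends of the rounds. Both read the same
    boundary configurations, so \<open>?v\<close> agrees with \<open>tl ?u\<close> on all rounds but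
    the last.\<close>
  let ?u = "map (\<lambda>r. fst (C r)) [0..<k]" and ?v = "map (\<lambda>r. fst (C (Suc r))) [0..<k]"
  have V: "?u \<in> vecs (shared A) k" "?v \<in> vecs (shared A) k"
    using CV by (auto simp: vecs_def valid_def)
  note V = V tl_vecs[OF V(1)]
  have v_last: "?v ! (k - 1) = s" using C(2) k by simp
  show ?thesis
  proof (cases "0 < num_trans A")
    case True
    obtain i1 l1 where i1: "ths0 ! hd ?O = (i1, l1, [])" "i1 < length (comps A)"
        "l1 \<in> local_inits (comps A ! i1)"
      using inits[of "hd ?O"] by (metis append_is_Nil_conv hd_in_set not_Cons_self2)
    let ?first = "Run (tl ?O = []) i1 l1 0 (tl ?u) ?u"
    let ?last = "Run True i l (k - 1) (tl ?u) ?v"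
    have q0: "?first \<in> seq_inits A k"
      using i1 V k s0 init_local by (simp add: seq_inits_def Run_in_locs C(1) c0)
    have "(pds_step (seq_pds A k))\<^sup>*\<^sup>* (?first, []) (?last, st)"
    proof (rule sequentialize[OF True k, where xs = ?O and cs = "\<lambda>r. snd (C r)" and
          cs' = "\<lambda>r. snd (C (Suc r))"])
      show "exec A ?O (?u ! r, snd (C r)) (?v ! r, snd (C (Suc r)))" if "r < k" for r
        using C(3)[OF that] that by simp
      show "\<exists>i l. snd (C 0) ! t = (i, l, []) \<and> i < length (comps A) \<and>
          l \<in> local_inits (comps A ! i)" if "t \<in> set ?O" for t
        using inits[OF that] by (simp add: C(1) c0)
      show "snd (C 0) ! hd ?O = (i1, l1, [])" using i1 by (simp add: C(1) c0)
      show "?v ! r = tl ?u ! r" if "Suc r < k" for r using that by (simp add: nth_tl)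
      show "snd (C (Suc (k - 1))) ! last ?O = (i, l, st)" using k exec(3) C(2) by simp
    qed (use O V in auto)
    moreover from seq_steps_locs[OF this] have "?last \<in> seq_locs A k"
      using q0 by (simp add: seq_inits_def)
    then have "?last \<in> seq_target A k i s l"
      using v_last unfolding seq_target_def by blast
    ultimately show ?thesis by (rule seq_reachableI[OF q0, rotated])
  next
    \<comment> \<open>Nothing has moved, so the visit is to an initial state. One \<open>Run\<close>
      location of round 0, with \<open>s\<close> in every entry, is then both initial and a
      target.\<close>
    case False
    then have "(s, ths) = c0" using valid_exec[OF ex \<open>valid c0\<close>] by simp
    then have i: "i < length (comps A)" "l \<in> local_inits (comps A ! i)" "s \<in> shared0 A"
      using inits[of t] exec(3) s0 c0 by auto
    let ?x = "replicate k s"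
    have "?x \<in> vecs (shared A) k" using shared0_shared[OF i(3)] by (auto simp: vecs_def)
    note x = this tl_vecs[OF this]
    have "Run True i l 0 (tl ?x) ?x \<in> seq_inits A k \<inter> seq_target A k i s l"
      using i k init_local x by (auto simp: seq_inits_def seq_target_def Run_in_locs)
    then show ?thesis by (blast intro: seq_reachableI)
  qed
qed

end

theorem theorem2:
  fixes A :: "('s, 'l, 'g) psys" and k :: nat
  assumes "wf_psys A"
  shows "wf_pds (seq_pds A k) \<and>
    (\<forall>i < length (comps A). \<forall>s \<in> shared A. \<forall>l \<in> local_locs (comps A ! i).
       k_round_reachable A k i s l \<longleftrightarrow> pds_reachable (seq_pds A k) (seq_target A k i s l)) \<and>
    card (locs (seq_pds A k)) \<le> 3 * (num_locals A * k ^ 2 * card (shared A) ^ (2 * k)) \<and>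
    card (delta (seq_pds A k)) \<le>
      8 * (num_locals A * num_trans A * k ^ 3 * card (shared A) ^ (2 * k - 1))"
proof -
  interpret psys A by (rule psys.intro[OF assms])
  have "k_round_reachable A k i s l \<longleftrightarrow> pds_reachable (seq_pds A k) (seq_target A k i s l)"
    for i s l using seq_sound seq_complete by blast
  moreover have "locs (seq_pds A k) = seq_locs A k" by (simp add: seq_pds_def)
  ultimately show ?thesis
    using wf_seq_pds card_seq_delta card_seq_locs[of k] by simp
qed

end
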